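(* Let $0<\mu<L$. Given $\epsilon > 0$, the gradient descent method with exact line search yields a solution with relative accuracy $\epsilon$ for any function $f\in \mathcal{F}_{\mu,L}(\mathbb{R}^n)$ after at most $$N = \left\lceil \frac{\frac{1}{2}\log\left(\frac{1}{\epsilon}\right)}{\log\left(\frac{L+\mu}{L-\mu}\right)}\right\rceil$$ iterations, i.e. $$\frac{f(\mathbf{x}_N) - f_*}{f(\mathbf{x}_0) - f_*} \le \epsilon ,$$ where $\mathbf{x}_0$ is the starting point, $\mathbf{x}_N$ is the $N$-th iterate and $f_*$ is the global minimum value of $f$. Moreover, this iteration bound is tight for the quadratic function $$f(\mathbf{x})=\frac12\sum_{i=1}^n\lambda_i x_i^2,\qquad 0<\mu=\lambda_1\le\lambda_2\le\cdots\le\lambda_n=L,$$ with starting point $\mathbf{x}_0=\left(\frac1\mu,0,\ldots,0,\frac1L\right)^{T}$.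
   Context: For $L>0$ and $\mu>0$, $\mathcal{F}_{\mu,L}(\mathbb{R}^n)$ denotes the class of $L$-smooth, $\mu$-strongly convex functions on $\mathbb{R}^n$, i.e. continuously differentiable functions $f:\mathbb{R}^n\to\mathbb{R}$ such that (1) $\mathbf{x}\mapsto f(\mathbf{x})-\frac{\mu}{2}\|\mathbf{x}\|^2$ is convex on $\mathbb{R}^n$, where $\|\cdot\|$ is the Euclidean norm; and (2) $\|\nabla f(\mathbf{x}+\Delta\mathbf{x})-\nabla f(\mathbf{x})\|\le L\|\Delta\mathbf{x}\|$ for all $\mathbf{x},\Delta\mathbf{x}\in\mathbb{R}^n$. Gradient descent method with exact line search: given $f\in\mathcal{F}_{\mu,L}(\mathbb{R}^n)$ and $\mathbf{x}_0\in\mathbb{R}^n$, for $i=0,1,\ldots$ set $\gamma=\operatorname{argmin}_{\gamma\in\mathbb{R}} f(\mathbf{x}_i-\gamma\nabla f(\mathbf{x}_i))$ and $\mathbf{x}_{i+1}=\mathbf{x}_i-\gamma\nabla f(\mathbf{x}_i)$. For the quadratic function and starting point in the claim, $f_*=0$ and the iterates satisfy $f(\mathbf{x}_{i+1})-f_*=\left(\frac{L-\mu}{L+\mu}\right)^2(f(\mathbf{x}_i)-f_* )$ for all $i=0,1,\ldots$; this equality is the sense in which the bound is tight. *)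

theory Defs
  imports "HOL-Analysis.Analysis"
begin

definition grad :: "('a::euclidean_space \<Rightarrow> real) \<Rightarrow> 'a \<Rightarrow> 'a" where
  "grad f x = (THE g. GDERIV f x :> g)"

definition smooth_strongly_convex ::
    "real \<Rightarrow> real \<Rightarrow> ('a::euclidean_space \<Rightarrow> real) set" where
  "smooth_strongly_convex \<mu> L =
     {f. (\<forall>x. f differentiable (at x)) \<and>
         continuous_on UNIV (grad f) \<and>
         convex_on UNIV (\<lambda>x. f x - \<mu> / 2 * (norm x)\<^sup>2) \<and>
         (\<forall>x dx. norm (grad f (x + dx) - grad f x) \<le> L * norm dx)}"

definition global_min :: "('a \<Rightarrow> real) \<Rightarrow> real" where
  "global_min f = (LEAST v. v \<in> range f)"

(* On a smooth strongly convex f the minimizing step exists.  It is unique unless grad f x = 0,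
   and then every step yields the same next iterate, so the choice made by arg_min is immaterial. *)
definition line_search_step :: "('a::euclidean_space \<Rightarrow> real) \<Rightarrow> 'a \<Rightarrow> real" where
  "line_search_step f x = arg_min (\<lambda>\<gamma>. f (x - \<gamma> *\<^sub>R grad f x)) (\<lambda>_. True)"

primrec gd_iterate :: "('a::euclidean_space \<Rightarrow> real) \<Rightarrow> 'a \<Rightarrow> nat \<Rightarrow> 'a" where
  "gd_iterate f x0 0 = x0"
| "gd_iterate f x0 (Suc i) =
     gd_iterate f x0 i
       - line_search_step f (gd_iterate f x0 i) *\<^sub>R grad f (gd_iterate f x0 i)"

(* For \<epsilon> > 1 the ceiling may be negative; nat turns this into zero iterations. *)
definition iteration_bound :: "real \<Rightarrow> real \<Rightarrow> real \<Rightarrow> nat" where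
  "iteration_bound \<mu> L \<epsilon> = nat \<lceil>(1 / 2 * ln (1 / \<epsilon>)) / ln ((L + \<mu>) / (L - \<mu>))\<rceil>"

definition diag_quadratic :: "real ^ 'n \<Rightarrow> real ^ 'n \<Rightarrow> real" where
  "diag_quadratic lam x = 1 / 2 * (\<Sum>i\<in>UNIV. lam $ i * (x $ i)\<^sup>2)"

(* (1/\<mu>, 0, ..., 0, 1/L): the first and last coordinates are those at the least and the greatest
   element of the linearly ordered index type. *)
definition worst_case_start :: "real \<Rightarrow> real \<Rightarrow> real ^ 'n::{finite,linorder}" where
  "worst_case_start \<mu> L =
     (\<chi> i. if i = Min UNIV then 1 / \<mu> else if i = Max UNIV then 1 / L else 0)"

end

theory Submission
  imports Defs
begin

text \<open>By exact line search, consecutive gradients are orthogonal. Weighting the interpolation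
  inequalities of smooth strongly convex functions between the current iterate, the next iterate and the
  minimizer by suitable nonnegative multipliers, and using this orthogonality, bounds the decrease of the
  objective in one step; what is left over is a sum of squares. Iterating gives the rate
  \<open>((L - \<mu>) / (L + \<mu>))\<^sup>2\<close> per step. On the quadratic every step attains this rate exactly, because the
  gradient keeps two entries of equal magnitude, at the extreme eigenvalues.\<close>

section \<open>Gradients and derivatives along lines\<close>

lemma GDERIV_unique:
  assumes "GDERIV f x :> a" "GDERIV f x :> b"
  shows "a = b"
proof -
  have "(\<lambda>h. inner h a) = (\<lambda>h. inner h b)"
    using assms unfolding gderiv_def by (rule has_derivative_unique)
  then have "inner h a = inner h b" for h
    by meson
  then show ?thesis
    using vector_eq_ldot by blast
qed

lemma grad_eqI: "GDERIV f x :> g \<Longrightarrow> grad f x = g"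
  unfolding grad_def using GDERIV_unique by blast

text \<open>In finite dimension the derivative \<open>D\<close> is represented by the vector
  \<open>adjoint D 1\<close>; with uniqueness, the definite description in \<open>grad\<close>
  therefore denotes.\<close>

lemma GDERIV_grad:
  fixes f :: "'a::euclidean_space \<Rightarrow> real"
  assumes "f differentiable (at x)"
  shows "GDERIV f x :> grad f x"
proof -
  obtain D where D: "(f has_derivative D) (at x)"
    using assms by (auto simp: differentiable_def)
  then have "linear D"
    by (rule has_derivative_linear)
  then have "D = (\<lambda>h. inner h (adjoint D 1))"
    using adjoint_works[of D _ 1] by auto
  then have "GDERIV f x :> adjoint D 1"
    using D by (simp add: gderiv_def)
  then show ?thesis
    using grad_eqI by metis
qed

lemma GDERIV_along_line:
  assumes "GDERIV f (x + t *\<^sub>R d) :> g"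
  shows "((\<lambda>s. f (x + s *\<^sub>R d)) has_real_derivative inner d g) (at t)"
proof -
  have "((\<lambda>s. x + s *\<^sub>R d) has_derivative (\<lambda>s. s *\<^sub>R d)) (at t)"
    by (auto intro!: derivative_eq_intros)
  from has_derivative_compose[OF this] assms
  have "((\<lambda>s. f (x + s *\<^sub>R d)) has_derivative (\<lambda>s. inner (s *\<^sub>R d) g)) (at t)"
    unfolding gderiv_def by fastforce
  then show ?thesis
    by (simp add: has_field_derivative_def mult.commute[of "inner d g"] mult_commute_abs)
qed

lemma GDERIV_norm_power2: "GDERIV (\<lambda>x. (norm x)\<^sup>2) x :> 2 *\<^sub>R x"
  unfolding gderiv_def power2_norm_eq_inner
  by (auto intro!: derivative_eq_intros simp: inner_commute)

section \<open>Tangent and quadratic bounds, and the interpolation inequality\<close>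

lemma convex_on_GDERIV_above_tangent:
  fixes h :: "'a::real_inner \<Rightarrow> real"
  assumes "convex_on UNIV h" and g: "GDERIV h x :> g"
  shows "h y \<ge> h x + inner g (y - x)"
proof -
  \<comment> \<open>Restricting \<open>h\<close> to the line through \<open>x\<close> and
    \<open>y\<close> reduces the claim to the tangent inequality in one variable, at 0.\<close>
  let ?k = "\<lambda>t::real. h (x + t *\<^sub>R (y - x))"
  have "convex_on UNIV ?k"
  proof (rule convex_onI)
    fix t a b :: real assume t: "t > 0" "t < 1"
    have "x + ((1 - t) *\<^sub>R a + t *\<^sub>R b) *\<^sub>R (y - x)
        = (1 - t) *\<^sub>R (x + a *\<^sub>R (y - x)) + t *\<^sub>R (x + b *\<^sub>R (y - x))"
      by (simp add: algebra_simps)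
    then show "?k ((1 - t) *\<^sub>R a + t *\<^sub>R b) \<le> (1 - t) * ?k a + t * ?k b"
      using convex_onD[OF assms(1), of t] t by simp
  qed simp
  moreover have "(?k has_real_derivative inner (y - x) g) (at 0)"
    using GDERIV_along_line[of h x 0 "y - x" g] g by simp
  ultimately have "inner (y - x) g * (1 - 0) \<le> ?k 1 - ?k 0"
    by (intro convex_on_imp_above_tangent[where A = UNIV]) auto
  then show ?thesis
    by (simp add: inner_commute)
qed

text \<open>The tangent inequality for \<open>f\<close> minus its quadratic part; the remaining
  quadratic terms combine to the squared norm of \<open>y - x\<close>.\<close>

lemma strongly_convex_lower_bound:
  fixes f :: "'a::euclidean_space \<Rightarrow> real"
  assumes "f \<in> smooth_strongly_convex \<mu> L"
  shows "f y \<ge> f x + inner (grad f x) (y - x) + \<mu> / 2 * (norm (y - x))\<^sup>2"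
proof -
  have "convex_on UNIV (\<lambda>x. f x - \<mu> / 2 * (norm x)\<^sup>2)" and f: "f differentiable (at x)"
    using assms by (auto simp: smooth_strongly_convex_def)
  moreover have "GDERIV (\<lambda>x. f x - \<mu> / 2 * (norm x)\<^sup>2) x :> grad f x - \<mu> *\<^sub>R x"
    using GDERIV_diff[OF GDERIV_grad[OF f] GDERIV_mult[OF GDERIV_const[of "\<mu> / 2"] GDERIV_norm_power2]]
    by simp
  ultimately have "f y - \<mu> / 2 * (norm y)\<^sup>2
      \<ge> f x - \<mu> / 2 * (norm x)\<^sup>2 + inner (grad f x - \<mu> *\<^sub>R x) (y - x)"
    by (intro convex_on_GDERIV_above_tangent)
  then show ?thesis
    by (simp add: power2_norm_eq_inner inner_diff_left inner_diff_right inner_commute field_simps)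
qed

text \<open>Along the segment from \<open>x\<close> to \<open>y\<close>, \<open>f\<close> minus its
  quadratic model has nonpositive derivative, by the Lipschitz bound and Cauchy-Schwarz.\<close>

lemma smooth_upper_bound:
  fixes f :: "'a::euclidean_space \<Rightarrow> real"
  assumes "f \<in> smooth_strongly_convex \<mu> L"
  shows "f y \<le> f x + inner (grad f x) (y - x) + L / 2 * (norm (y - x))\<^sup>2"
proof -
  define d where "d = y - x"
  let ?k = "\<lambda>t. f (x + t *\<^sub>R d) - (t * inner d (grad f x) + L / 2 * (norm d)\<^sup>2 * t\<^sup>2)"
  have diff: "f differentiable (at z)" for z
    using assms by (auto simp: smooth_strongly_convex_def)
  have "?k 1 \<le> ?k 0"
  proof (rule DERIV_nonpos_imp_nonincreasing[where f = ?k])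
    fix t :: real assume t: "0 \<le> t" "t \<le> 1"
    have lip: "norm (grad f (x + t *\<^sub>R d) - grad f x) \<le> L * norm (t *\<^sub>R d)"
      using assms by (simp add: smooth_strongly_convex_def del: norm_scaleR)
    have "(?k has_real_derivative inner d (grad f (x + t *\<^sub>R d))
          - (inner d (grad f x) + L / 2 * (norm d)\<^sup>2 * (2 * t))) (at t)"
      by (auto intro!: derivative_eq_intros GDERIV_along_line GDERIV_grad diff)
    moreover have "inner d (grad f (x + t *\<^sub>R d) - grad f x) \<le> norm d * (L * norm (t *\<^sub>R d))"
      by (rule order.trans[OF norm_cauchy_schwarz mult_left_mono[OF lip norm_ge_zero]])
    ultimately show "\<exists>D. (?k has_real_derivative D) (at t) \<and> D \<le> 0"
      using t by (intro exI conjI) (auto simp: inner_diff_right power2_eq_square algebra_simps)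
  qed simp
  then show ?thesis
    by (simp add: d_def inner_commute)
qed

text \<open>Compare the lower bound at \<open>x\<close> with the upper bound at \<open>y\<close> in the point where this gives the most.\<close>

lemma smooth_strongly_convex_interpolation:
  fixes f :: "'a::euclidean_space \<Rightarrow> real"
  assumes f: "f \<in> smooth_strongly_convex \<mu> L" and "\<mu> < L"
  shows "2 * (L - \<mu>) * (f y - f x - inner (grad f x) (y - x))
    \<ge> (norm (grad f y - grad f x))\<^sup>2 - 2 * \<mu> * inner (grad f y - grad f x) (y - x)
      + \<mu> * L * (norm (y - x))\<^sup>2"
proof -
  define D where "D = L - \<mu>"
  define d where "d = y - x"
  \<comment> \<open>\<open>w\<close> is the gradient difference of \<open>f\<close> minus its
    quadratic part. The gap between the upper bound at \<open>y\<close> and the lower bound at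
    \<open>x\<close>, as a function of \<open>z\<close>, has gradient
    \<open>w + D *\<^sub>R (z - y)\<close>, so this \<open>z\<close> minimizes it.\<close>
  define w where "w = grad f y - grad f x - \<mu> *\<^sub>R d"
  define z where "z = y - (1 / D) *\<^sub>R w"
  have D: "D > 0"
    using assms by (simp add: D_def)
  have zx: "z - x = d - (1 / D) *\<^sub>R w" and zy: "z - y = - (1 / D) *\<^sub>R w"
    by (simp_all add: z_def d_def)
  have gy: "grad f y = w + grad f x + \<mu> *\<^sub>R d"
    by (simp add: w_def)
  have 1: "f z \<ge> f x + (inner (grad f x) d - inner (grad f x) w / D)
      + \<mu> / 2 * ((norm d)\<^sup>2 - 2 * inner d w / D + (norm w)\<^sup>2 / D\<^sup>2)"
    using strongly_convex_lower_bound[OF f, of x z] unfolding zx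
    by (simp add: power2_norm_eq_inner inner_diff_left inner_diff_right inner_commute)
      (simp add: power2_eq_square algebra_simps)
  have 2: "f z \<le> f y - ((norm w)\<^sup>2 + inner (grad f x) w + \<mu> * inner d w) / D
      + L / 2 * ((norm w)\<^sup>2 / D\<^sup>2)"
    using smooth_upper_bound[OF f, of z y] unfolding zy gy
    by (simp add: inner_add_left inner_commute[of d] dot_square_norm power_divide field_simps)
  have L: "L = D + \<mu>"
    by (simp add: D_def)
  \<comment> \<open>Chaining the two bounds eliminates \<open>f z\<close>; the terms with
    \<open>inner (grad f x) w\<close> and \<open>inner d w\<close> cancel.\<close>
  have "f y - f x - inner (grad f x) d \<ge> (norm w)\<^sup>2 / D - (L - \<mu>) / 2 * ((norm w)\<^sup>2 / D\<^sup>2)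
      + \<mu> / 2 * (norm d)\<^sup>2"
    using 1 2 by (simp add: algebra_simps add_divide_distrib diff_divide_distrib)
  also have "(norm w)\<^sup>2 / D - (L - \<mu>) / 2 * ((norm w)\<^sup>2 / D\<^sup>2) = (norm w)\<^sup>2 / (2 * D)"
    using D by (simp add: L field_simps power2_eq_square)
  finally have "2 * D * ((norm w)\<^sup>2 / (2 * D) + \<mu> / 2 * (norm d)\<^sup>2)
      \<le> 2 * D * (f y - f x - inner (grad f x) d)"
    using D by (intro mult_left_mono) auto
  moreover have "2 * D * ((norm w)\<^sup>2 / (2 * D) + \<mu> / 2 * (norm d)\<^sup>2)
      = (norm w)\<^sup>2 + \<mu> * D * (norm d)\<^sup>2"
    using D by (simp add: field_simps)
  moreover have "(norm w)\<^sup>2 + \<mu> * D * (norm d)\<^sup>2 = (norm (grad f y - grad f x))\<^sup>2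
      - 2 * \<mu> * inner (grad f y - grad f x) d + \<mu> * L * (norm d)\<^sup>2"
    unfolding power2_norm_eq_inner w_def D_def
    by (simp add: inner_diff_left inner_diff_right inner_commute algebra_simps)
  ultimately show ?thesis
    by (simp add: D_def d_def)
qed

section \<open>Existence of minimizers and stationarity\<close>

lemma continuous_on_smooth_strongly_convex:
  fixes f :: "'a::euclidean_space \<Rightarrow> real"
  assumes "f \<in> smooth_strongly_convex \<mu> L"
  shows "continuous_on S f"
  using assms
  by (auto simp: smooth_strongly_convex_def
      intro!: continuous_at_imp_continuous_on differentiable_imp_continuous_within)

text \<open>Quadratic growth confines the search to a compact ball. General closed sets are allowed
  so that the result serves both the whole space and the line of a line search.\<close>

lemma smooth_strongly_convex_attains_inf:
  fixes f :: "'a::euclidean_space \<Rightarrow> real"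
  assumes f: "f \<in> smooth_strongly_convex \<mu> L" and "\<mu> > 0" and S: "closed S" "S \<noteq> {}"
  obtains x where "x \<in> S" "\<And>y. y \<in> S \<Longrightarrow> f x \<le> f y"
proof -
  obtain a where a: "a \<in> S"
    using S by blast
  \<comment> \<open>From this radius on, the quadratic term of the lower bound at \<open>a\<close>
    outweighs the linear one.\<close>
  define r where "r = 2 * norm (grad f a) / \<mu>"
  have "r \<ge> 0"
    using \<open>\<mu> > 0\<close> by (simp add: r_def)
  have outside: "f a \<le> f y" if "y \<notin> cball a r" for y
  proof -
    have "r \<le> norm (y - a)"
      using that by (simp add: dist_norm norm_minus_commute)
    then have "2 * norm (grad f a) \<le> \<mu> * norm (y - a)"
      using \<open>\<mu> > 0\<close> by (simp add: r_def field_simps)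
    then have "2 * norm (grad f a) * norm (y - a) \<le> \<mu> * norm (y - a) * norm (y - a)"
      by (rule mult_right_mono) simp
    moreover have "\<bar>inner (grad f a) (y - a)\<bar> \<le> norm (grad f a) * norm (y - a)"
      by (rule Cauchy_Schwarz_ineq2)
    ultimately show ?thesis
      using strongly_convex_lower_bound[OF f, of a y] by (simp add: power2_eq_square)
  qed
  have "compact (cball a r \<inter> S)"
    using S(1) by (intro compact_Int_closed) auto
  moreover have ar: "a \<in> cball a r \<inter> S"
    using a \<open>r \<ge> 0\<close> by simp
  then have "cball a r \<inter> S \<noteq> {}"
    by blast
  ultimately obtain x where x: "x \<in> cball a r \<inter> S" "\<forall>y \<in> cball a r \<inter> S. f x \<le> f y"
    using continuous_attains_inf continuous_on_smooth_strongly_convex[OF f] by metis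
  show ?thesis
  proof
    show "x \<in> S"
      using x by simp
    show "f x \<le> f y" if "y \<in> S" for y
    proof (cases "y \<in> cball a r")
      case False
      have "f x \<le> f a"
        using x(2) ar by blast
      then show ?thesis
        using outside[OF False] by simp
    qed (use x(2) that in blast)
  qed
qed

lemma global_min_eqI: "(\<And>y. f x \<le> f y) \<Longrightarrow> global_min f = f x" for f :: "'a \<Rightarrow> real"
  unfolding global_min_def by (rule Least_equality) auto

text \<open>In the direction of the gradient itself, the derivative is the squared norm of the
  gradient, and it vanishes at a minimum.\<close>

lemma grad_eq_0_if_minimal:
  fixes f :: "'a::euclidean_space \<Rightarrow> real"
  assumes "f differentiable (at x)" "\<And>y. f x \<le> f y"
  shows "grad f x = 0"
proof -
  have "((\<lambda>s. f (x + s *\<^sub>R grad f x)) has_real_derivative inner (grad f x) (grad f x)) (at 0)"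
    using GDERIV_along_line[of f x 0 "grad f x"] GDERIV_grad[OF assms(1)] by simp
  then have "inner (grad f x) (grad f x) = 0"
    by (rule DERIV_local_min[of _ _ _ 1]) (auto simp: assms)
  then show ?thesis
    by simp
qed

section \<open>Exact line search and the contraction in one step\<close>

lemma line_search_minimal:
  fixes f :: "'a::euclidean_space \<Rightarrow> real"
  assumes f: "f \<in> smooth_strongly_convex \<mu> L" and "\<mu> > 0"
  shows "f (x - line_search_step f x *\<^sub>R grad f x) \<le> f (x - \<gamma> *\<^sub>R grad f x)"
proof -
  \<comment> \<open>\<open>arg_min\<close> is informative only if a minimizing step exists. The
    search line is a translated span, closed even when the gradient vanishes, so the minimum over it
    is attained.\<close>
  let ?S = "(+) x ` span {grad f x}"
  have "closed ?S"
    by (intro closed_translation closed_subspace) simp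
  moreover have "?S \<noteq> {}"
    using span_zero by blast
  ultimately obtain z where z: "z \<in> ?S" "\<And>y. y \<in> ?S \<Longrightarrow> f z \<le> f y"
    using smooth_strongly_convex_attains_inf[OF assms] by metis
  obtain c where c: "z = x - c *\<^sub>R grad f x"
  proof -
    obtain k where "z = x + k *\<^sub>R grad f x"
      using z(1) by (auto simp: span_singleton)
    then show ?thesis
      by (intro that[of "- k"]) simp
  qed
  have "f z \<le> f (x - k *\<^sub>R grad f x)" for k
    using span_mul[OF span_base, of "grad f x" "{grad f x}" "- k"]
    by (intro z(2) image_eqI[where x = "- k *\<^sub>R grad f x"]) auto
  then show ?thesis
    unfolding line_search_step_def c
    using arg_min_equality[of "\<lambda>_. True" c "\<lambda>k. f (x - k *\<^sub>R grad f x)"] by simp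
qed

text \<open>The inner product is the derivative of \<open>f\<close> along the search line at the
  minimizing point.\<close>

lemma line_search_orthogonal:
  fixes f :: "'a::euclidean_space \<Rightarrow> real"
  assumes f: "f \<in> smooth_strongly_convex \<mu> L" and "\<mu> > 0"
  shows "inner (grad f x) (grad f (x - line_search_step f x *\<^sub>R grad f x)) = 0"
proof -
  let ?t = "- line_search_step f x"
  have "((\<lambda>s. f (x + s *\<^sub>R grad f x)) has_real_derivative
      inner (grad f x) (grad f (x + ?t *\<^sub>R grad f x))) (at ?t)"
    using f by (intro GDERIV_along_line GDERIV_grad) (simp add: smooth_strongly_convex_def)
  then have "inner (grad f x) (grad f (x + ?t *\<^sub>R grad f x)) = 0"
  proof (rule DERIV_local_min[of _ _ _ 1])
    show "\<forall>y. \<bar>?t - y\<bar> < 1 \<longrightarrow> f (x + ?t *\<^sub>R grad f x) \<le> f (x + y *\<^sub>R grad f x)"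
      using line_search_minimal[OF assms, of x "- y" for y] by simp
  qed simp
  then show ?thesis
    by simp
qed

text \<open>The dual certificate of the performance estimation problem of de Klerk, Glineur and Taylor, scaled
  to clear denominators.\<close>

lemma contraction_certificate:
  fixes L \<mu> :: real and u v p q :: "'a::real_inner"
  assumes pq: "inner p q = 0" and uq: "inner u q = inner v q"
  shows "2 * (L - \<mu>) * L * (L + 3 * \<mu>) * ((L - \<mu>)\<^sup>2 * F0 - (L + \<mu>)\<^sup>2 * F1)
      = L * (L + 3 * \<mu>) *
        ((L + \<mu>) * (L - \<mu>) * (2 * (L - \<mu>) * (F0 - F1 - inner q (u - v))
          - ((norm (p - q))\<^sup>2 - 2 * \<mu> * inner (p - q) (u - v) + \<mu> * L * (norm (u - v))\<^sup>2))
        + 2 * \<mu> * (L - \<mu>) * (2 * (L - \<mu>) * (- F0 + inner p u)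
          - ((norm p)\<^sup>2 - 2 * \<mu> * inner p u + \<mu> * L * (norm u)\<^sup>2))
        + 2 * \<mu> * (L + \<mu>) * (2 * (L - \<mu>) * (- F1 + inner q v)
          - ((norm q)\<^sup>2 - 2 * \<mu> * inner q v + \<mu> * L * (norm v)\<^sup>2)))
      + (L - \<mu>) * \<mu> * (norm ((L * (L + 3 * \<mu>)) *\<^sub>R u - (L * (L + \<mu>)) *\<^sub>R v
          - (3 * L + \<mu>) *\<^sub>R p - (L + \<mu>) *\<^sub>R q))\<^sup>2
      + (norm ((2 * \<mu> * L * (L + \<mu>)) *\<^sub>R v - ((L - \<mu>)\<^sup>2) *\<^sub>R p - ((L + \<mu>)\<^sup>2) *\<^sub>R q))\<^sup>2"
proof -
  \<comment> \<open>These equations bring all inner products to a normal form with the two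
    hypotheses built in, leaving a polynomial identity.\<close>
  have e: "inner q p = 0" "inner q u = inner v q" "inner q v = inner v q" "inner v u = inner u v"
    "inner p u = inner u p" "inner p v = inner v p"
    using pq uq by (auto simp: inner_commute)
  show ?thesis
    unfolding power2_norm_eq_inner inner_diff_left inner_diff_right inner_scaleR_left
      inner_scaleR_right e pq uq
    by algebra
qed

text \<open>Every term on the right of the certificate is nonnegative, and the factor in front of
  the wanted difference is positive.\<close>

lemma line_search_contraction:
  fixes f :: "'a::euclidean_space \<Rightarrow> real"
  assumes f: "f \<in> smooth_strongly_convex \<mu> L" and \<mu>: "0 < \<mu>" "\<mu> < L"
  shows "f (x - line_search_step f x *\<^sub>R grad f x) - global_min f
    \<le> ((L - \<mu>) / (L + \<mu>))\<^sup>2 * (f x - global_min f)"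
proof -
  obtain xs where xs: "\<And>y. f xs \<le> f y"
    using smooth_strongly_convex_attains_inf[OF f \<mu>(1), of UNIV] by auto
  have gs: "grad f xs = 0"
    using f xs by (intro grad_eq_0_if_minimal) (auto simp: smooth_strongly_convex_def)
  define x1 where "x1 = x - line_search_step f x *\<^sub>R grad f x"
  define u where "u = x - xs"
  define v where "v = x1 - xs"
  define p where "p = grad f x"
  define q where "q = grad f x1"
  define F0 where "F0 = f x - f xs"
  define F1 where "F1 = f x1 - f xs"
  have pq: "inner p q = 0"
    using line_search_orthogonal[OF f \<mu>(1)] by (simp add: p_def q_def x1_def)
  have uv: "x - x1 = u - v"
    by (simp add: u_def v_def)
  have "u - v = line_search_step f x *\<^sub>R p"
    by (simp add: u_def v_def x1_def p_def)
  \<comment> \<open>The step from \<open>x\<close> to \<open>x1\<close> is a multiple of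
    \<open>p\<close>, to which \<open>q\<close> is orthogonal.\<close>
  then have uq: "inner u q = inner v q"
    using pq by (metis inner_diff_left inner_scaleR_left mult_zero_right right_minus_eq)
  \<comment> \<open>Slacks of three interpolation inequalities: between \<open>x1\<close> and
    \<open>x\<close>, and between each of these and the minimizer \<open>xs\<close>, where the
    gradient is zero.\<close>
  define I01 where "I01 = 2 * (L - \<mu>) * (F0 - F1 - inner q (u - v))
      - ((norm (p - q))\<^sup>2 - 2 * \<mu> * inner (p - q) (u - v) + \<mu> * L * (norm (u - v))\<^sup>2)"
  define Is0 where "Is0 = 2 * (L - \<mu>) * (- F0 + inner p u)
      - ((norm p)\<^sup>2 - 2 * \<mu> * inner p u + \<mu> * L * (norm u)\<^sup>2)"
  define Is1 where "Is1 = 2 * (L - \<mu>) * (- F1 + inner q v)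
      - ((norm q)\<^sup>2 - 2 * \<mu> * inner q v + \<mu> * L * (norm v)\<^sup>2)"
  define s1 where "s1 = (L * (L + 3 * \<mu>)) *\<^sub>R u - (L * (L + \<mu>)) *\<^sub>R v
      - (3 * L + \<mu>) *\<^sub>R p - (L + \<mu>) *\<^sub>R q"
  define s2 where "s2 = (2 * \<mu> * L * (L + \<mu>)) *\<^sub>R v - ((L - \<mu>)\<^sup>2) *\<^sub>R p - ((L + \<mu>)\<^sup>2) *\<^sub>R q"
  have I01: "I01 \<ge> 0"
    using smooth_strongly_convex_interpolation[OF f \<mu>(2), where x = x1 and y = x]
    by (simp add: I01_def F0_def F1_def p_def q_def uv)
  have Is0: "Is0 \<ge> 0"
    using smooth_strongly_convex_interpolation[OF f \<mu>(2), where x = x and y = xs]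
    by (simp add: Is0_def F0_def p_def u_def gs inner_diff_right norm_minus_commute algebra_simps)
  have Is1: "Is1 \<ge> 0"
    using smooth_strongly_convex_interpolation[OF f \<mu>(2), where x = x1 and y = xs]
    by (simp add: Is1_def F1_def q_def v_def gs inner_diff_right norm_minus_commute algebra_simps)
  have cert: "2 * (L - \<mu>) * L * (L + 3 * \<mu>) * ((L - \<mu>)\<^sup>2 * F0 - (L + \<mu>)\<^sup>2 * F1)
      = L * (L + 3 * \<mu>) * ((L + \<mu>) * (L - \<mu>) * I01 + 2 * \<mu> * (L - \<mu>) * Is0 + 2 * \<mu> * (L + \<mu>) * Is1)
        + (L - \<mu>) * \<mu> * (norm s1)\<^sup>2 + (norm s2)\<^sup>2"
    unfolding I01_def Is0_def Is1_def s1_def s2_def by (rule contraction_certificate[OF pq uq])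
  have "0 \<le> 2 * (L - \<mu>) * L * (L + 3 * \<mu>) * ((L - \<mu>)\<^sup>2 * F0 - (L + \<mu>)\<^sup>2 * F1)"
    unfolding cert using I01 Is0 Is1 \<mu> by (intro add_nonneg_nonneg mult_nonneg_nonneg) auto
  moreover have "0 < 2 * (L - \<mu>) * L * (L + 3 * \<mu>)"
    using \<mu> by simp
  ultimately have "(L + \<mu>)\<^sup>2 * F1 \<le> (L - \<mu>)\<^sup>2 * F0"
    by (simp add: zero_le_mult_iff)
  then have "F1 \<le> ((L - \<mu>) / (L + \<mu>))\<^sup>2 * F0"
    using \<mu> by (simp add: power_divide field_simps)
  moreover have "global_min f = f xs"
    using xs by (rule global_min_eqI)
  ultimately show ?thesis
    by (simp add: F0_def F1_def x1_def)
qed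

section \<open>From the rate to the iteration bound\<close>

lemma global_min_le:
  fixes f :: "'a::euclidean_space \<Rightarrow> real"
  assumes f: "f \<in> smooth_strongly_convex \<mu> L" and "\<mu> > 0"
  shows "global_min f \<le> f x"
proof -
  obtain xs where "\<And>y. f xs \<le> f y"
    using smooth_strongly_convex_attains_inf[OF assms, of UNIV] by auto
  then show ?thesis
    using global_min_eqI[of f xs] by simp
qed

lemma gd_iterate_rate:
  fixes f :: "'a::euclidean_space \<Rightarrow> real"
  assumes "f \<in> smooth_strongly_convex \<mu> L" "0 < \<mu>" "\<mu> < L"
  shows "f (gd_iterate f x k) - global_min f
    \<le> ((L - \<mu>) / (L + \<mu>)) ^ (2 * k) * (f x - global_min f)"
proof (induction k)
  case (Suc k)
  have "f (gd_iterate f x (Suc k)) - global_min f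
      \<le> ((L - \<mu>) / (L + \<mu>))\<^sup>2 * (f (gd_iterate f x k) - global_min f)"
    using line_search_contraction[OF assms] by simp
  also have "\<dots> \<le> ((L - \<mu>) / (L + \<mu>))\<^sup>2
      * (((L - \<mu>) / (L + \<mu>)) ^ (2 * k) * (f x - global_min f))"
    by (intro mult_left_mono Suc.IH) simp
  finally show ?case
    by (simp add: power2_eq_square mult.assoc)
qed simp

text \<open>Taking logarithms makes the condition linear in \<open>k\<close>. An equivalence is
  needed: one direction gives the accuracy guarantee, the other its tightness.\<close>

lemma rate_power_le_iff:
  fixes \<mu> L \<epsilon> :: real
  assumes "0 < \<mu>" "\<mu> < L" "\<epsilon> > 0"
  shows "((L - \<mu>) / (L + \<mu>)) ^ (2 * k) \<le> \<epsilon> \<longleftrightarrow> iteration_bound \<mu> L \<epsilon> \<le> k"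
proof -
  define c where "c = ln ((L + \<mu>) / (L - \<mu>))"
  have c: "c > 0"
    using assms by (simp add: c_def)
  have "((L - \<mu>) / (L + \<mu>)) ^ (2 * k) \<le> \<epsilon> \<longleftrightarrow> ln (((L - \<mu>) / (L + \<mu>)) ^ (2 * k)) \<le> ln \<epsilon>"
    using assms by (subst ln_le_cancel_iff) auto
  also have "ln (((L - \<mu>) / (L + \<mu>)) ^ (2 * k)) = - (2 * real k * c)"
    using assms by (simp add: c_def ln_realpow ln_div algebra_simps)
  also have "- (2 * real k * c) \<le> ln \<epsilon> \<longleftrightarrow> (1 / 2 * ln (1 / \<epsilon>)) / c \<le> real k"
    using assms c by (simp add: ln_div field_simps) linarith
  \<comment> \<open>Since \<open>k\<close> is a natural number, neither the ceiling nor the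
    truncation by \<open>nat\<close> changes the comparison.\<close>
  also have "\<dots> \<longleftrightarrow> iteration_bound \<mu> L \<epsilon> \<le> k"
    unfolding iteration_bound_def c_def by (simp add: nat_le_iff ceiling_le_iff)
  finally show ?thesis .
qed

lemma gd_iterate_accuracy:
  fixes f :: "'a::euclidean_space \<Rightarrow> real"
  assumes f: "f \<in> smooth_strongly_convex \<mu> L" and \<mu>: "0 < \<mu>" "\<mu> < L" and "\<epsilon> > 0"
  shows "(f (gd_iterate f x (iteration_bound \<mu> L \<epsilon>)) - global_min f) / (f x - global_min f) \<le> \<epsilon>"
proof (cases "f x = global_min f")
  case False
  let ?N = "iteration_bound \<mu> L \<epsilon>"
  have pos: "f x - global_min f > 0"
    using False global_min_le[OF f \<mu>(1), of x] by simp
  have "f (gd_iterate f x ?N) - global_min f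
      \<le> ((L - \<mu>) / (L + \<mu>)) ^ (2 * ?N) * (f x - global_min f)"
    by (rule gd_iterate_rate[OF f \<mu>])
  also have "\<dots> \<le> \<epsilon> * (f x - global_min f)"
    using pos rate_power_le_iff[OF \<mu> \<open>\<epsilon> > 0\<close>] by (intro mult_right_mono) auto
  finally show ?thesis
    using pos by (simp add: divide_le_eq)
\<comment> \<open>From a minimal start the denominator is 0, so the quotient is 0 by
  convention.\<close>
qed (use \<open>\<epsilon> > 0\<close> in simp)

text \<open>Supplies the content that the relative accuracy loses when its denominator is 0: the
  rate bounds the gap above by 0, minimality below.\<close>

lemma gd_iterate_of_minimal:
  fixes f :: "'a::euclidean_space \<Rightarrow> real"
  assumes "f \<in> smooth_strongly_convex \<mu> L" "0 < \<mu>" "\<mu> < L" and "f x = global_min f"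
  shows "f (gd_iterate f x k) = global_min f"
  using gd_iterate_rate[OF assms(1-3), of x k] global_min_le[OF assms(1,2), of "gd_iterate f x k"] assms(4)
  by simp

section \<open>Diagonal quadratics: gradient, membership in the class, minimum\<close>

lemma GDERIV_diag_quadratic: "GDERIV (diag_quadratic lam) x :> (\<chi> i. lam $ i * x $ i)"
proof -
  have nth: "((\<lambda>x. x $ i) has_derivative (\<lambda>h. h $ i)) (at x)" for i
    by (rule bounded_linear.has_derivative[OF bounded_linear_vec_nth has_derivative_ident])
  show ?thesis
    unfolding gderiv_def diag_quadratic_def inner_vec_def
    by (auto intro!: derivative_eq_intros nth simp: sum_distrib_left algebra_simps)
qed

lemma grad_diag_quadratic: "grad (diag_quadratic lam) x = (\<chi> i. lam $ i * x $ i)"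
  by (rule grad_eqI[OF GDERIV_diag_quadratic])

lemma smooth_strongly_convex_diag_quadratic:
  fixes lam :: "real ^ 'n"
  assumes "0 \<le> \<mu>" and bounds: "\<And>i. \<mu> \<le> lam $ i" "\<And>i. lam $ i \<le> L"
  shows "diag_quadratic lam \<in> smooth_strongly_convex \<mu> L"
  unfolding smooth_strongly_convex_def
proof (intro CollectI conjI allI)
  fix x :: "real ^ 'n"
  show "diag_quadratic lam differentiable (at x)"
    using GDERIV_diag_quadratic unfolding gderiv_def differentiable_def by blast
next
  show "continuous_on UNIV (grad (diag_quadratic lam))"
    unfolding grad_diag_quadratic by (intro continuous_intros)
next
  \<comment> \<open>Subtracting the quadratic part leaves a diagonal quadratic with coefficients
    \<open>lam $ i - \<mu>\<close>, which are nonnegative.\<close>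
  have eq: "diag_quadratic lam x - \<mu> / 2 * (norm x)\<^sup>2 = (\<Sum>i\<in>UNIV. (lam $ i - \<mu>) / 2 * (x $ i)\<^sup>2)" for x
    unfolding power2_norm_eq_inner
    by (simp add: diag_quadratic_def inner_vec_def sum_distrib_left sum_subtractf[symmetric]
        power2_eq_square field_simps)
  show "convex_on UNIV (\<lambda>x. diag_quadratic lam x - \<mu> / 2 * (norm x)\<^sup>2)"
    unfolding eq
  proof (rule convex_onI)
    fix t :: real and x y :: "real ^ 'n" assume t: "t > 0" "t < 1"
    have sq: "c * ((1 - t) * a + t * b)\<^sup>2 \<le> (1 - t) * (c * a\<^sup>2) + t * (c * b\<^sup>2)"
      if "c \<ge> 0" for a b c :: real
    proof -
      \<comment> \<open>This product is exactly the convexity gap of the scaled square.\<close>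
      have "0 \<le> c * (t * (1 - t) * (a - b)\<^sup>2)"
        using t that by (intro mult_nonneg_nonneg) auto
      then show ?thesis
        by (simp add: power2_eq_square algebra_simps)
    qed
    have "(lam $ i - \<mu>) / 2 * ((((1 - t) *\<^sub>R x + t *\<^sub>R y) $ i)\<^sup>2)
        \<le> (1 - t) * ((lam $ i - \<mu>) / 2 * (x $ i)\<^sup>2) + t * ((lam $ i - \<mu>) / 2 * (y $ i)\<^sup>2)" for i
      using sq[of "(lam $ i - \<mu>) / 2" "x $ i" "y $ i"] bounds(1)[of i] by simp
    then show "(\<Sum>i\<in>UNIV. (lam $ i - \<mu>) / 2 * ((((1 - t) *\<^sub>R x + t *\<^sub>R y) $ i)\<^sup>2))
        \<le> (1 - t) * (\<Sum>i\<in>UNIV. (lam $ i - \<mu>) / 2 * (x $ i)\<^sup>2)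
          + t * (\<Sum>i\<in>UNIV. (lam $ i - \<mu>) / 2 * (y $ i)\<^sup>2)"
      unfolding sum_distrib_left sum.distrib[symmetric] by (rule sum_mono)
  qed simp
next
  fix x dx :: "real ^ 'n"
  have "L \<ge> 0"
    using assms(1) order.trans[OF bounds] by linarith
  have "norm (grad (diag_quadratic lam) (x + dx) - grad (diag_quadratic lam) x) \<le> norm (L *\<^sub>R dx)"
  proof (rule norm_le_componentwise_cart)
    fix i
    have "\<bar>lam $ i\<bar> \<le> \<bar>L\<bar>"
      using assms(1) bounds[of i] by simp
    moreover have "(grad (diag_quadratic lam) (x + dx) - grad (diag_quadratic lam) x) $ i = lam $ i * dx $ i"
      by (simp add: grad_diag_quadratic algebra_simps)
    ultimately show "norm ((grad (diag_quadratic lam) (x + dx) - grad (diag_quadratic lam) x) $ i)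
        \<le> norm ((L *\<^sub>R dx) $ i)"
      by (simp add: abs_mult mult_right_mono)
  qed
  then show "norm (grad (diag_quadratic lam) (x + dx) - grad (diag_quadratic lam) x) \<le> L * norm dx"
    using \<open>L \<ge> 0\<close> by simp
qed

lemma global_min_diag_quadratic:
  assumes "\<And>i. 0 \<le> lam $ i"
  shows "global_min (diag_quadratic lam) = 0"
proof -
  have "global_min (diag_quadratic lam) = diag_quadratic lam 0"
    using assms by (intro global_min_eqI) (auto simp: diag_quadratic_def intro!: sum_nonneg)
  then show ?thesis
    by (simp add: diag_quadratic_def)
qed

section \<open>Tightness: the zigzag from the worst-case start\<close>

lemma sum_two_points:
  fixes g :: "'n::finite \<Rightarrow> real"
  assumes "a \<noteq> b" "\<And>i. i \<noteq> a \<Longrightarrow> i \<noteq> b \<Longrightarrow> g i = 0"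
  shows "sum g UNIV = g a + g b"
proof -
  have "sum g UNIV = sum g {a, b}"
    using assms(2) by (intro sum.mono_neutral_right) auto
  then show ?thesis
    using assms(1) by simp
qed

text \<open>Exact line search on a diagonal quadratic, from a point supported on two coordinates where the
  gradient entries have equal magnitude, uses the step \<open>2 / (lam $ a + lam $ b)\<close>; the gradient entries
  stay equal in magnitude and the zigzag never improves.\<close>

lemma gd_iterate_zigzag:
  fixes lam :: "real ^ 'n"
  assumes lam: "0 < \<mu>" "\<mu> < L" "\<And>i. \<mu> \<le> lam $ i" "\<And>i. lam $ i \<le> L"
    and a: "lam $ a = \<mu>" and b: "lam $ b = L"
  shows "gd_iterate (diag_quadratic lam) (\<chi> i. if i = a then 1 / \<mu> else if i = b then 1 / L else 0) k
    = (\<chi> i. ((L - \<mu>) / (L + \<mu>)) ^ k * (if i = a then 1 / \<mu> else if i = b then (- 1) ^ k / L else 0))"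
proof (induction k)
  case (Suc k)
  define r where "r = (L - \<mu>) / (L + \<mu>)"
  define x :: "real ^ 'n" where
    "x = (\<chi> i. r ^ k * (if i = a then 1 / \<mu> else if i = b then (- 1) ^ k / L else 0))"
  let ?f = "diag_quadratic lam"
  define \<gamma> where "\<gamma> = line_search_step ?f x"
  have ab: "a \<noteq> b"
    using a b lam(2) by auto
  have f: "?f \<in> smooth_strongly_convex \<mu> L"
    using lam by (intro smooth_strongly_convex_diag_quadratic) auto
  have "r > 0"
    using lam by (simp add: r_def)
  have g: "grad ?f x = (\<chi> i. r ^ k * (if i = a then 1 else if i = b then (- 1) ^ k else 0))"
    using lam a b by (auto simp: grad_diag_quadratic x_def vec_eq_iff)
  \<comment> \<open>The step is found without evaluating \<open>arg_min\<close>: orthogonality of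
    consecutive gradients is a linear equation in \<gamma>, nondegenerate because
    \<open>r ^ k\<close> is nonzero.\<close>
  have "0 = inner (grad ?f x) (grad ?f (x - \<gamma> *\<^sub>R grad ?f x))"
    using line_search_orthogonal[OF f lam(1), of x] by (simp add: \<gamma>_def)
  also have "\<dots> = r ^ k * (r ^ k * (1 - \<gamma> * \<mu>)) + r ^ k * (- 1) ^ k * (r ^ k * (- 1) ^ k * (1 - \<gamma> * L))"
    unfolding inner_vec_def using ab lam(1,2) a b
    by (subst sum_two_points[OF ab]) (auto simp: g, auto simp: grad_diag_quadratic x_def field_simps)
  also have "\<dots> = r ^ k * r ^ k * (2 - \<gamma> * (L + \<mu>))"
    by (simp add: algebra_simps flip: power_mult_distrib)
  finally have "2 - \<gamma> * (L + \<mu>) = 0"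
    using \<open>r > 0\<close> by simp
  then have \<gamma>: "\<gamma> = 2 / (L + \<mu>)"
    using \<open>r > 0\<close> lam(1,2) by (simp add: field_simps)
  \<comment> \<open>Two forms of the same step, showing that coordinate \<open>a\<close> is
    multiplied by \<open>r\<close> and coordinate \<open>b\<close> by \<open>- r\<close>.\<close>
  have \<gamma>_a: "\<gamma> = 1 / \<mu> - r / \<mu>" and \<gamma>_b: "\<gamma> = 1 / L + r / L"
    using lam(1,2) by (simp_all add: \<gamma> r_def divide_simps)
  have "r ^ k / \<mu> - \<gamma> * r ^ k = r * r ^ k / \<mu>"
    unfolding \<gamma>_a by (simp add: algebra_simps)
  moreover have "r ^ k * (- 1) ^ k / L - \<gamma> * (r ^ k * (- 1) ^ k) = - (r * r ^ k * (- 1) ^ k / L)"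
    unfolding \<gamma>_b by (simp add: algebra_simps)
  ultimately have "x - \<gamma> *\<^sub>R grad ?f x
      = (\<chi> i. r ^ Suc k * (if i = a then 1 / \<mu> else if i = b then (- 1) ^ Suc k / L else 0))"
    unfolding g using ab by (auto simp: x_def vec_eq_iff)
  then show ?case
    using Suc.IH by (simp add: \<gamma>_def x_def r_def)
qed (simp add: vec_eq_iff)

text \<open>Squaring removes the alternating sign, so both coordinates contribute with the same
  factor and the rate is attained at every \<open>k\<close>.\<close>

lemma diag_quadratic_zigzag:
  fixes lam :: "real ^ 'n"
  assumes lam: "0 < \<mu>" "\<mu> < L" "\<And>i. \<mu> \<le> lam $ i" "\<And>i. lam $ i \<le> L"
    and a: "lam $ a = \<mu>" and b: "lam $ b = L"
  shows "diag_quadratic lam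
      (gd_iterate (diag_quadratic lam) (\<chi> i. if i = a then 1 / \<mu> else if i = b then 1 / L else 0) k)
    = ((L - \<mu>) / (L + \<mu>)) ^ (2 * k) * ((1 / \<mu> + 1 / L) / 2)"
proof -
  have ab: "a \<noteq> b"
    using a b lam(2) by auto
  have "\<mu> * (r * (1 / \<mu>))\<^sup>2 = r\<^sup>2 * (1 / \<mu>)" for r
    using lam(1) by (simp add: power2_eq_square)
  moreover have "L * (r * ((- 1) ^ k / L))\<^sup>2 = r\<^sup>2 * (1 / L)" for r
    using lam(1,2) by (simp add: power2_eq_square flip: power_mult_distrib)
  ultimately show ?thesis
    unfolding gd_iterate_zigzag[OF assms] diag_quadratic_def power_even_eq
    by (subst sum_two_points[OF ab]) (use ab a b in \<open>simp_all add: ring_distribs\<close>)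
qed

theorem corollary1p4:
  fixes \<mu> L :: real
  assumes "0 < \<mu>" and "\<mu> < L"
  shows "(\<forall>\<epsilon>>0. \<forall>f \<in> smooth_strongly_convex \<mu> L. \<forall>x0 :: real ^ 'n::{finite,linorder}.
            (f (gd_iterate f x0 (iteration_bound \<mu> L \<epsilon>)) - global_min f)
              / (f x0 - global_min f) \<le> \<epsilon> \<and>
            (f x0 = global_min f \<longrightarrow>
              f (gd_iterate f x0 (iteration_bound \<mu> L \<epsilon>)) = global_min f)) \<and>
         (\<forall>lam :: real ^ 'n::{finite,linorder}.
            mono (($) lam) \<and> lam $ Min UNIV = \<mu> \<and> lam $ Max UNIV = L \<longrightarrow>
            (let f = diag_quadratic lam; x = gd_iterate f (worst_case_start \<mu> L) in
               f \<in> smooth_strongly_convex \<mu> L \<and>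
               global_min f = 0 \<and>
               (\<forall>i. f (x (Suc i)) - global_min f =
                      ((L - \<mu>) / (L + \<mu>))\<^sup>2 * (f (x i) - global_min f)) \<and>
               (\<forall>\<epsilon>>0. \<forall>k < iteration_bound \<mu> L \<epsilon>.
                  (f (x k) - global_min f) / (f (x 0) - global_min f) > \<epsilon>)))"
proof (intro conjI allI ballI impI)
  fix \<epsilon> :: real and f :: "real ^ 'n::{finite,linorder} \<Rightarrow> real" and x0 :: "real ^ 'n::{finite,linorder}"
  assume "\<epsilon> > 0" "f \<in> smooth_strongly_convex \<mu> L"
  then show "(f (gd_iterate f x0 (iteration_bound \<mu> L \<epsilon>)) - global_min f)
      / (f x0 - global_min f) \<le> \<epsilon>"
    using assms by (intro gd_iterate_accuracy)
next
  fix \<epsilon> :: real and f :: "real ^ 'n::{finite,linorder} \<Rightarrow> real" and x0 :: "real ^ 'n::{finite,linorder}"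
  assume "f \<in> smooth_strongly_convex \<mu> L" "f x0 = global_min f"
  then show "f (gd_iterate f x0 (iteration_bound \<mu> L \<epsilon>)) = global_min f"
    using assms by (intro gd_iterate_of_minimal)
next
  fix lam :: "real ^ 'n::{finite,linorder}"
  assume lam: "mono (($) lam) \<and> lam $ Min UNIV = \<mu> \<and> lam $ Max UNIV = L"
  define f where "f = diag_quadratic lam"
  define x where "x = gd_iterate f (worst_case_start \<mu> L)"
  have bounds: "\<mu> \<le> lam $ i" "lam $ i \<le> L" for i
    using lam monoD[of "($) lam" "Min UNIV" i] monoD[of "($) lam" i "Max UNIV"] by auto
  have f: "f \<in> smooth_strongly_convex \<mu> L"
    unfolding f_def using assms bounds by (intro smooth_strongly_convex_diag_quadratic) auto
  have gm: "global_min f = 0"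
    unfolding f_def using assms bounds(1) by (intro global_min_diag_quadratic) (meson less_imp_le order.trans)
  have fx: "f (x k) = ((L - \<mu>) / (L + \<mu>)) ^ (2 * k) * ((1 / \<mu> + 1 / L) / 2)" for k
    unfolding f_def x_def worst_case_start_def
    using assms bounds lam by (intro diag_quadratic_zigzag) auto
  have "f (x (Suc i)) = ((L - \<mu>) / (L + \<mu>))\<^sup>2 * f (x i)" for i
    by (simp add: fx power2_eq_square)
  then have step: "f (x (Suc i)) - global_min f = ((L - \<mu>) / (L + \<mu>))\<^sup>2 * (f (x i) - global_min f)" for i
    by (simp add: gm)
  \<comment> \<open>The quotient equals the rate power exactly, as the initial value cancels; below
    the bound, the equivalence for rate powers makes it exceed \<epsilon>.\<close>
  have "(f (x k) - global_min f) / (f (x 0) - global_min f) > \<epsilon>"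
    if "\<epsilon> > 0" "k < iteration_bound \<mu> L \<epsilon>" for \<epsilon> k
  proof -
    have "1 / \<mu> + 1 / L > 0"
      using assms by (simp add: add_pos_pos)
    then show ?thesis
      using rate_power_le_iff[OF assms that(1), of k] that(2) unfolding gm fx by simp
  qed
  with f gm step show "let f = diag_quadratic lam; x = gd_iterate f (worst_case_start \<mu> L) in
      f \<in> smooth_strongly_convex \<mu> L \<and> global_min f = 0 \<and>
      (\<forall>i. f (x (Suc i)) - global_min f = ((L - \<mu>) / (L + \<mu>))\<^sup>2 * (f (x i) - global_min f)) \<and>
      (\<forall>\<epsilon>>0. \<forall>k < iteration_bound \<mu> L \<epsilon>.
        (f (x k) - global_min f) / (f (x 0) - global_min f) > \<epsilon>)"
    unfolding Let_def f_def[symmetric] x_def[symmetric] by (intro conjI allI impI)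
qed

end
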